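(* Let $G$ be a cyclic group of order $n$ and let $1<d_1<d_2<\cdots<d_k<n$ be the divisors of $n$ strictly between $1$ and $n$. Then the total number of edges in the endomorphism graph of $G$ is $$\binom{n}{2}-\sum_{\substack{1\le i<j\le k\\ d_i\nmid d_j}}\phi(d_i)\phi(d_j).$$
   Context: The endomorphism graph of a group $G$ is the simple undirected graph with vertex set $G$ in which distinct $x,y$ are adjacent if and only if some endomorphism of $G$ maps $x$ to $y$ or maps $y$ to $x$. Here $\phi$ is Euler's totient function. *)

theory Defs
  imports "HOL-Algebra.Algebra" "HOL-Number_Theory.Totient"
begin

definition endo_adj :: "('a, 'b) monoid_scheme \<Rightarrow> 'a \<Rightarrow> 'a \<Rightarrow> bool" where
  "endo_adj G x y \<longleftrightarrow>
     x \<in> carrier G \<and> y \<in> carrier G \<and> x \<noteq> y \<and>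
     ((\<exists>f \<in> hom G G. f x = y) \<or> (\<exists>f \<in> hom G G. f y = x))"

text \<open>A simple undirected graph is a pair of a vertex set and a set of edges, each edge being a
  two-element set of vertices; thus every undirected edge is counted once by \<open>card\<close>.\<close>

definition endomorphism_graph :: "('a, 'b) monoid_scheme \<Rightarrow> 'a set \<times> 'a set set" where
  "endomorphism_graph G = (carrier G, {{x, y} | x y. endo_adj G x y})"

definition graph_edges :: "'v set \<times> 'v set set \<Rightarrow> 'v set set" where
  "graph_edges \<Gamma> = snd \<Gamma>"

end

theory Submission
  imports Defs
begin

text \<open>In a finite cyclic group, an endomorphism carries \<open>x\<close> to \<open>y\<close> exactly when the order of \<open>y\<close>
  divides the order of \<open>x\<close>: orders can only shrink to divisors under homomorphisms, and conversely
  \<open>y\<close> is then a power of \<open>x\<close>, while power maps are endomorphisms of an abelian group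
  (\<open>endomorphism_maps_iff_ord_dvd\<close>). Hence \<open>x\<close> and \<open>y\<close> are non-adjacent exactly when neither of
  their orders divides the other.

  So each non-edge is an unordered pair whose two orders are different, and naming first the
  element of smaller order turns it into an ordered pair in a unique way. Both orders lie strictly
  between \<open>1\<close> and \<open>n\<close>, because \<open>1\<close> divides and \<open>n\<close> is divisible by every order. Since there are
  \<open>\<phi>(m)\<close> elements of order \<open>m\<close> for every divisor \<open>m\<close> of \<open>n\<close> (\<open>card_elements_of_order\<close>), the
  non-edges are counted by the sum in the theorem, and the edges are the remaining two-element
  subsets of the group.\<close>

lemma (in group) pow_cong_ord:
  fixes k l :: nat
  assumes "x \<in> carrier G" and "[k = l] (mod ord x)"
  shows "x [^] k = x [^] l"
proof -
  have "x [^] m = x [^] (m mod ord x)" for m :: nat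
  proof -
    have "x [^] m = x [^] (ord x * (m div ord x) + m mod ord x)"
      by simp
    also have "\<dots> = (x [^] ord x) [^] (m div ord x) \<otimes> x [^] (m mod ord x)"
      using assms(1) by (simp only: nat_pow_mult nat_pow_pow nat_pow_closed)
    finally show ?thesis
      using assms(1) by simp
  qed
  then show ?thesis
    using assms(2) by (metis cong_def)
qed

text \<open>The exponents run from \<open>1\<close> to \<open>n\<close> because the totient counts residues in that range;
  the identity is the power with exponent \<open>n\<close>.\<close>

lemma (in group) cyclic_group_generator:
  assumes "cyclic_group G" and "finite (carrier G)"
  obtains g where "g \<in> carrier G" and "ord g = order G"
    and "bij_betw (\<lambda>k::nat. g [^] k) {0<..order G} (carrier G)"
proof -
  obtain g where g: "g \<in> carrier G" and gen: "subgroup_generated G {g} = G"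
    using assms(1) unfolding cyclic_group_def by blast
  have ord: "ord g = order G"
    using cyclic_order_is_ord[OF g] gen by simp
  have inj: "inj_on (\<lambda>k::nat. g [^] k) {0<..order G}"
  proof -
    have "{0<..order G} = {1..ord g}"
      unfolding ord by auto
    then show ?thesis
      using ord_inj'[OF g] by simp
  qed
  have "(\<lambda>k::nat. g [^] k) ` {0<..order G} = carrier G"
  proof (rule card_subset_eq[OF assms(2)])
    show "(\<lambda>k::nat. g [^] k) ` {0<..order G} \<subseteq> carrier G"
      using g by blast
    show "card ((\<lambda>k::nat. g [^] k) ` {0<..order G}) = card (carrier G)"
      by (simp only: card_image[OF inj] card_greaterThanAtMost) (simp add: order_def)
  qed
  with inj have "bij_betw (\<lambda>k::nat. g [^] k) {0<..order G} (carrier G)"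
    by (simp add: bij_betw_def)
  with g ord show ?thesis
    by (rule that)
qed

text \<open>Write \<open>x = g\<^sup>a\<close> and \<open>y = g\<^sup>b\<close> for a generator \<open>g\<close>. The orders are \<open>n / gcd(n, a)\<close> and
  \<open>n / gcd(n, b)\<close>, so divisibility of orders means that \<open>gcd(n, a)\<close> divides \<open>b\<close>, which is the
  solvability condition for \<open>a u \<equiv> b\<close> modulo \<open>n\<close>.\<close>

lemma (in group) cyclic_group_power_if_ord_dvd:
  assumes "cyclic_group G" and fin: "finite (carrier G)"
    and "x \<in> carrier G" and "y \<in> carrier G" and dvd: "ord y dvd ord x"
  obtains u :: nat where "y = x [^] u"
proof -
  obtain g where g: "g \<in> carrier G" and ord: "ord g = order G"
    and bij: "bij_betw (\<lambda>k::nat. g [^] k) {0<..order G} (carrier G)"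
    using cyclic_group_generator[OF assms(1,2)] .
  obtain a where a: "a \<in> {0<..order G}" "x = g [^] a"
    using assms(3) bij_betw_imp_surj_on[OF bij] by (metis imageE)
  obtain b where b: "b \<in> {0<..order G}" "y = g [^] b"
    using assms(4) bij_betw_imp_surj_on[OF bij] by (metis imageE)
  let ?n = "order G"
  have n: "?n > 0"
    using a by auto
  have "?n div gcd ?n b dvd ?n div gcd ?n a"
    using dvd a b g by (simp add: ord_pow_gen ord)
  then obtain c where "?n div gcd ?n a = ?n div gcd ?n b * c"
    by blast
  then have "?n div gcd ?n a * gcd ?n a * gcd ?n b = ?n div gcd ?n b * gcd ?n b * (c * gcd ?n a)"
    by (simp add: mult_ac)
  then have "?n * gcd ?n b = ?n * (c * gcd ?n a)"
    by simp
  then have "gcd ?n b = c * gcd ?n a"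
    using n by simp
  then have "gcd a ?n dvd b"
    by (metis dvd_triv_right dvd_trans gcd_dvd2 gcd.commute)
  then obtain u where "[a * u = b] (mod ?n)"
    using cong_solve_dvd_nat by blast
  then have "g [^] (a * u) = g [^] b"
    by (intro pow_cong_ord) (simp_all add: g ord)
  then have "y = x [^] u"
    using a b g by (simp add: nat_pow_pow)
  then show ?thesis
    by (rule that)
qed

lemma (in group) ord_hom_dvd:
  assumes "f \<in> hom G G" and "x \<in> carrier G"
  shows "ord (f x) dvd ord x"
proof -
  have "f x [^] ord x = f (x [^] ord x)"
    using assms hom_nat_pow[of f G G x "ord x"] by (simp add: is_group)
  also have "\<dots> = \<one>"
    using assms by (simp add: hom_one is_group)
  finally show ?thesis
    using assms by (simp add: pow_eq_id hom_in_carrier)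
qed

lemma (in group) endomorphism_maps_iff_ord_dvd:
  assumes "cyclic_group G" and "finite (carrier G)"
    and x: "x \<in> carrier G" and y: "y \<in> carrier G"
  shows "(\<exists>f \<in> hom G G. f x = y) \<longleftrightarrow> ord y dvd ord x"
proof
  assume "\<exists>f \<in> hom G G. f x = y"
  then show "ord y dvd ord x"
    using ord_hom_dvd x by blast
next
  assume "ord y dvd ord x"
  then obtain u :: nat where u: "y = x [^] u"
    using cyclic_group_power_if_ord_dvd[OF assms] by blast
  interpret comm_group G
    using assms(1) by (rule cyclic_imp_abelian_group)
  have "(\<lambda>z. z [^] u) \<in> hom G G"
    by (auto simp: hom_def nat_pow_distrib)
  then show "\<exists>f \<in> hom G G. f x = y"
    using u by (intro bexI[of _ "\<lambda>z. z [^] u"]) simp_all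
qed

text \<open>The power \<open>g\<^sup>k\<close> of a generator has order \<open>m\<close> exactly when \<open>gcd(k, n) = n / m\<close>, and the
  exponents with a prescribed gcd are counted by the totient.\<close>

lemma (in group) card_elements_of_order:
  assumes "cyclic_group G" and "finite (carrier G)" and m: "m dvd order G"
  shows "card {x \<in> carrier G. ord x = m} = totient m"
proof -
  obtain g where g: "g \<in> carrier G" and ord: "ord g = order G"
    and bij: "bij_betw (\<lambda>k::nat. g [^] k) {0<..order G} (carrier G)"
    using cyclic_group_generator[OF assms(1,2)] .
  let ?n = "order G"
  have n: "?n > 0"
    using assms(2) by (simp add: order_gt_0_iff_finite)
  obtain c where c: "?n = m * c"
    using m by blast
  have div_div: "?n div (?n div m) = m" and div_dvd: "?n div m dvd ?n"
    using n by (simp_all add: c)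
  have ord_pow_eq: "ord (g [^] k) = m \<longleftrightarrow> gcd k ?n = ?n div m" if "k \<in> {0<..?n}" for k
  proof -
    have "ord (g [^] k) = ?n div gcd k ?n"
      using that g by (simp add: ord_pow_gen ord gcd.commute)
    moreover have "?n div gcd k ?n = m \<longleftrightarrow> gcd k ?n = ?n div m"
    proof -
      have "?n div (?n div d) = d" if "d dvd ?n" for d
        using that n by (auto elim!: dvdE)
      then show ?thesis
        using m by (metis gcd_dvd2)
    qed
    ultimately show ?thesis
      by simp
  qed
  have "(\<lambda>k::nat. g [^] k) ` {k \<in> {0<..?n}. gcd k ?n = ?n div m} = {x \<in> carrier G. ord x = m}"
    unfolding bij_betw_imp_surj_on[OF bij, symmetric] using ord_pow_eq by blast
  then have "bij_betw (\<lambda>k::nat. g [^] k) {k \<in> {0<..?n}. gcd k ?n = ?n div m}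
      {x \<in> carrier G. ord x = m}"
    by (intro bij_betw_subset[OF bij]) auto
  then have "card {x \<in> carrier G. ord x = m} = card {k \<in> {0<..?n}. gcd k ?n = ?n div m}"
    by (rule bij_betw_same_card[symmetric])
  also have "\<dots> = totient (?n div (?n div m))"
    using n div_dvd by (rule card_gcd_eq_totient)
  finally show ?thesis
    unfolding div_div .
qed

text \<open>The set on the right holds one ordered pair per non-edge. If \<open>ord x < ord y\<close>, then
  \<open>ord y\<close> cannot divide the positive number \<open>ord x\<close>, so only one of the two
  non-divisibilities has to be imposed.\<close>

lemma (in group) card_edges_eq_choose_minus_incomparable:
  assumes "cyclic_group G" and fin: "finite (carrier G)"
  shows "int (card (graph_edges (endomorphism_graph G))) = int (order G choose 2) -
    int (card {(x, y). x \<in> carrier G \<and> y \<in> carrier G \<and> ord x < ord y \<and> \<not> ord x dvd ord y})"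
    (is "_ = _ - int (card ?T)")
proof -
  let ?E = "graph_edges (endomorphism_graph G)"
  let ?P = "{A. A \<subseteq> carrier G \<and> card A = 2}"
  let ?pair = "\<lambda>(x, y). {x, y}"
  have adj: "endo_adj G x y \<longleftrightarrow>
      x \<in> carrier G \<and> y \<in> carrier G \<and> x \<noteq> y \<and> (ord y dvd ord x \<or> ord x dvd ord y)" for x y
    using endomorphism_maps_iff_ord_dvd[OF assms] unfolding endo_adj_def by blast
  have edge_iff: "{x, y} \<in> ?E \<longleftrightarrow> endo_adj G x y" for x y
    unfolding graph_edges_def endomorphism_graph_def by (auto simp: adj doubleton_eq_iff)
  have not_dvd: "\<not> ord y dvd ord x" if "x \<in> carrier G" "ord x < ord y" for x y
    using that ord_ge_1[OF fin, of x] by (auto dest: dvd_imp_le)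
  have finP: "finite ?P"
    using fin by simp
  have sub: "?E \<subseteq> ?P"
    unfolding graph_edges_def endomorphism_graph_def by (auto simp: adj)
  have "?P - ?E = ?pair ` ?T"
  proof (intro equalityI subsetI)
    fix A assume A: "A \<in> ?P - ?E"
    then obtain x y where xy: "A = {x, y}" "x \<noteq> y" "x \<in> carrier G" "y \<in> carrier G"
      by (auto simp: card_2_iff)
    with A have nd: "\<not> ord y dvd ord x" "\<not> ord x dvd ord y"
      using edge_iff adj by auto
    then have "ord x \<noteq> ord y"
      by auto
    then have "(x, y) \<in> ?T \<or> (y, x) \<in> ?T"
      using xy nd by auto
    moreover have "A = ?pair (x, y)" "A = ?pair (y, x)"
      using xy by auto
    ultimately show "A \<in> ?pair ` ?T"
      by (elim disjE) (rule image_eqI, assumption+)+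
  next
    fix A assume "A \<in> ?pair ` ?T"
    then obtain x y where xy: "A = {x, y}" "x \<in> carrier G" "y \<in> carrier G" "ord x < ord y"
        "\<not> ord x dvd ord y"
      by auto
    then have "x \<noteq> y"
      by auto
    moreover have "{x, y} \<notin> ?E"
      unfolding edge_iff adj using xy not_dvd by blast
    ultimately show "A \<in> ?P - ?E"
      using xy by simp
  qed
  moreover have "inj_on ?pair ?T"
    by (auto simp: inj_on_def doubleton_eq_iff)
  ultimately have "card ?T = card (?P - ?E)"
    by (simp add: card_image)
  also have "\<dots> = card ?P - card ?E"
    using finP sub by (intro card_Diff_subset finite_subset[OF sub])
  finally have "int (card ?T) = int (card ?P) - int (card ?E)"
    using card_mono[OF finP sub] by simp
  moreover have "card ?P = order G choose 2"
    using n_subsets[OF fin] by (simp add: order_def)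
  ultimately show ?thesis
    by simp
qed

theorem theorem5p2:
  fixes G :: "('a, 'b) monoid_scheme" and n k :: nat and d :: "nat \<Rightarrow> nat"
  assumes "group G" and "cyclic_group G" and "finite (carrier G)" and "order G = n"
    and "strict_mono_on {1..k} d"
    and "d ` {1..k} = {m. m dvd n \<and> 1 < m \<and> m < n}"
  shows "int (card (graph_edges (endomorphism_graph G))) =
           int (n choose 2) -
           (\<Sum>(i, j) \<in> {(i, j). 1 \<le> i \<and> i < j \<and> j \<le> k \<and> \<not> d i dvd d j}.
              int (totient (d i)) * int (totient (d j)))"
proof -
  interpret group G by fact
  let ?I = "{(i, j). 1 \<le> i \<and> i < j \<and> j \<le> k \<and> \<not> d i dvd d j}"
  let ?T = "{(x, y). x \<in> carrier G \<and> y \<in> carrier G \<and> ord x < ord y \<and> \<not> ord x dvd ord y}"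
  let ?O = "\<lambda>m. {x \<in> carrier G. ord x = m}"
  have d_less_iff: "d i < d j \<longleftrightarrow> i < j" if "i \<in> {1..k}" "j \<in> {1..k}" for i j
    using that assms(5) by (simp add: strict_mono_on_less)
  have d_eq_iff: "d i = d j \<longleftrightarrow> i = j" if "i \<in> {1..k}" "j \<in> {1..k}" for i j
    using d_less_iff[OF that] d_less_iff[OF that(2,1)] by (metis less_irrefl nat_neq_iff)
  have d_dvd: "d i dvd order G" if "i \<in> {1..k}" for i
    using that assms(4,6) by blast
  have T: "?T = (\<Union>(i, j) \<in> ?I. ?O (d i) \<times> ?O (d j))"
  proof (intro equalityI subsetI)
    fix p assume "p \<in> ?T"
    then obtain x y where xy: "p = (x, y)" "x \<in> carrier G" "y \<in> carrier G" "ord x < ord y"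
        "\<not> ord x dvd ord y"
      by auto
    have dvd: "ord x dvd n" "ord y dvd n"
      using ord_dvd_group_order xy assms(4) by auto
    have "ord x \<noteq> 1" "ord y \<noteq> n"
      using xy(5) dvd by auto
    moreover have "1 \<le> ord x" "ord y \<le> n"
      using ord_ge_1 ord_le_group_order xy assms(3,4) by auto
    ultimately have "ord x \<in> d ` {1..k}" "ord y \<in> d ` {1..k}"
      unfolding assms(6) using dvd xy(4) by auto
    then obtain i j where ij: "i \<in> {1..k}" "j \<in> {1..k}" "ord x = d i" "ord y = d j"
      by auto
    then have "(i, j) \<in> ?I"
      using xy d_less_iff by auto
    then show "p \<in> (\<Union>(i, j) \<in> ?I. ?O (d i) \<times> ?O (d j))"
      using xy ij by blast
  next
    fix p assume "p \<in> (\<Union>(i, j) \<in> ?I. ?O (d i) \<times> ?O (d j))"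
    then show "p \<in> ?T"
      using d_less_iff by auto
  qed
  have finI: "finite ?I"
    by (rule finite_subset[of _ "{1..k} \<times> {1..k}"]) auto
  have "card ?T = (\<Sum>p \<in> ?I. card (case p of (i, j) \<Rightarrow> ?O (d i) \<times> ?O (d j)))"
    unfolding T
  proof (rule card_UN_disjoint[OF finI])
    show "\<forall>p \<in> ?I. finite (case p of (i, j) \<Rightarrow> ?O (d i) \<times> ?O (d j))"
      using assms(3) by auto
    show "\<forall>p \<in> ?I. \<forall>q \<in> ?I. p \<noteq> q \<longrightarrow>
        (case p of (i, j) \<Rightarrow> ?O (d i) \<times> ?O (d j)) \<inter> (case q of (i, j) \<Rightarrow> ?O (d i) \<times> ?O (d j)) = {}"
      using d_eq_iff by auto
  qed
  also have "\<dots> = (\<Sum>(i, j) \<in> ?I. totient (d i) * totient (d j))"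
    using card_elements_of_order[OF assms(2,3) d_dvd]
    by (intro sum.cong) (auto simp: card_cartesian_product)
  finally have "int (card ?T) = (\<Sum>(i, j) \<in> ?I. int (totient (d i)) * int (totient (d j)))"
    by (simp add: case_prod_unfold)
  then show ?thesis
    using card_edges_eq_choose_minus_incomparable[OF assms(2,3)] assms(4) by simp
qed

end
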